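(* Let $(a_k)_{k\in\mathbb{N}}$ be a sequence in $\mathbb{F}$ with $a_0\neq0$ and let $\mathbf{E}$ be the associated functional all of whose indeterminates have the same moments, i.e. $\mathbf{E}\,x_i^k=a_k$ for all $i,k\in\mathbb{N}$ and $\mathbf{E}$ is multiplicative over distinct indeterminates. Let $\{p_n(x_0)\mid n\in\mathbb{N}\}$ be an orthogonal polynomial system for $\mathbf{E}\colon\mathbb{F}[x_0]\to\mathbb{F}$ such that, for every $n$, $p_n(x_0)$ has pairwise distinct roots $\zeta_1,\ldots,\zeta_n\in\mathbb{F}$ (depending on $n$). Let $n,k,N\in\mathbb{P}$ with $2k(N-1)\leq 2n-1$. Then $$\mathbf{E}\,\Delta(x_1,x_2,\ldots,x_N)^{2k}=\sum_{\substack{(i_1,i_2,\ldots,i_N)\\ 1\leq i_j\leq n}}c_{i_1}c_{i_2}\cdots c_{i_N}\,\Delta(\zeta_{i_1},\zeta_{i_2},\ldots,\zeta_{i_N})^{2k},$$ where $\zeta_1,\ldots,\zeta_n$ are the roots of $p_n(x_0)$ and $c_1,\ldots,c_n\in\mathbb{F}$ are the coefficients determined by $a_h=\sum_{i=1}^n c_i\,\zeta_i^h$ for $0\le h\le 2n-1$.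
   Context: $\mathbb{F}$ is a field of characteristic zero; $\mathbb{N}$ and $\mathbb{P}$ are the sets of nonnegative and positive integers; $x_0,x_1,x_2,\ldots$ are independent indeterminates. On $\mathbb{F}[x_0]$, $\mathbf{E}$ is the linear functional $x_0^k\mapsto a_k$; on polynomials in $x_1,\ldots,x_N$ it is the linear functional $\mathbf{E}\,x_1^{k_1}\cdots x_N^{k_N}=a_{k_1}a_{k_2}\cdots a_{k_N}$ (exponents $k_i=0$ contribute a factor $a_0$). An orthogonal polynomial system for $\mathbf{E}\colon\mathbb{F}[x_0]\to\mathbb{F}$ is a set $\{p_n(x_0)\mid n\in\mathbb{N}\}$ of polynomials with $\deg p_n=n$ ($p_0$ a nonzero constant) and $\mathbf{E}\,p_k(x_0)p_n(x_0)=0$ for all $k\ne n$. Vandermonde polynomial: $\Delta(z_1,\ldots,z_N)=\prod_{1\le i<j\le N}(z_j-z_i)$, with $\Delta(z_1)=1$. The coefficients $c_i$ are also given explicitly by $$c_i=\frac{\mathbf{E}\,\Delta(\zeta_1,\ldots,\zeta_{i-1},x_0,\zeta_{i+1},\ldots,\zeta_n)}{\Delta(\zeta_1,\zeta_2,\ldots,\zeta_n)}\qquad(1\le i\le n).$$ *)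

theory Defs
  imports
    "HOL-Computational_Algebra.Polynomial"
    "HOL-Library.Poly_Mapping"
    "HOL-Library.FuncSet"
begin

definition functional :: "(nat \<Rightarrow> 'a::comm_ring_1) \<Rightarrow> 'a poly \<Rightarrow> 'a"
  where "functional a q = (\<Sum>h\<le>degree q. coeff q h * a h)"

definition orthogonal_polynomial_system ::
    "(nat \<Rightarrow> 'a::field_char_0) \<Rightarrow> (nat \<Rightarrow> 'a poly) \<Rightarrow> bool"
  where "orthogonal_polynomial_system a p \<longleftrightarrow>
    (\<forall>n. p n \<noteq> 0 \<and> degree (p n) = n) \<and>
    (\<forall>k n. k \<noteq> n \<longrightarrow> functional a (p k * p n) = 0)"

text \<open>
  Multivariate polynomials in indeterminates \<open>x\<^sub>0, x\<^sub>1, \<dots>\<close> form the monoid algebra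
  over the finitely supported exponent vectors; multiplication is the convolution
  product of \<^type>\<open>poly_mapping\<close>.
\<close>

type_synonym 'a mpoly = "(nat \<Rightarrow>\<^sub>0 nat) \<Rightarrow>\<^sub>0 'a"

definition mvar :: "nat \<Rightarrow> 'a::comm_ring_1 mpoly"
  where "mvar i = Poly_Mapping.single (Poly_Mapping.single i 1) 1"

text \<open>
  The functional on polynomials in \<open>x\<^sub>1, \<dots>, x\<^sub>N\<close>. The number \<open>N\<close> of variables is a
  parameter because a variable absent from a monomial contributes the factor \<open>a 0\<close>,
  which need not be 1. The value is only meaningful on polynomials in which no other
  indeterminate occurs.
\<close>

definition mfunctional :: "nat \<Rightarrow> (nat \<Rightarrow> 'a::comm_ring_1) \<Rightarrow> 'a mpoly \<Rightarrow> 'a"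
  where "mfunctional N a q =
    (\<Sum>m\<in>Poly_Mapping.keys q. Poly_Mapping.lookup q m *
       (\<Prod>i\<in>{1..N}. a (Poly_Mapping.lookup m i)))"

definition vandermonde :: "nat \<Rightarrow> (nat \<Rightarrow> 'a::comm_ring_1) \<Rightarrow> 'a"
  where "vandermonde N z = (\<Prod>(i, j)\<in>{(i, j). 1 \<le> i \<and> i < j \<and> j \<le> N}. z j - z i)"

lemma functional_monom: "functional a (monom 1 h) = a h"
proof -
  have "functional a (monom 1 h) = (\<Sum>i\<le>h. if i = h then a i else 0)"
    unfolding functional_def by (intro sum.cong) (auto simp: degree_monom_eq)
  then show ?thesis by simp
qed

lemma mfunctional_alt:
  assumes "finite A" "Poly_Mapping.keys q \<subseteq> A"
  shows "mfunctional N a q =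
    (\<Sum>m\<in>A. Poly_Mapping.lookup q m * (\<Prod>i\<in>{1..N}. a (Poly_Mapping.lookup m i)))"
  unfolding mfunctional_def using assms
  by (intro sum.mono_neutral_left) (auto simp: in_keys_iff)

lemma mfunctional_add: "mfunctional N a (q + r) = mfunctional N a q + mfunctional N a r"
proof -
  let ?A = "Poly_Mapping.keys q \<union> Poly_Mapping.keys r"
  have "Poly_Mapping.keys (q + r) \<subseteq> ?A" by (rule Poly_Mapping.keys_add)
  then show ?thesis
    by (simp add: mfunctional_alt[of ?A] lookup_add ring_distribs sum.distrib)
qed

lemma mfunctional_single:
  "mfunctional N a (Poly_Mapping.single m c) = c * (\<Prod>i\<in>{1..N}. a (Poly_Mapping.lookup m i))"
  by (simp add: mfunctional_alt[of "{m}"])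

lemma mvar_power: "mvar i ^ e = Poly_Mapping.single (Poly_Mapping.single i e) 1"
  by (induction e) (simp_all add: mvar_def mult_single single_add[symmetric])

lemma prod_mvar_power:
  "finite A \<Longrightarrow> (\<Prod>i\<in>A. mvar i ^ e i) =
     Poly_Mapping.single (\<Sum>i\<in>A. Poly_Mapping.single i (e i)) 1"
  by (induction A rule: finite_induct) (simp_all add: mvar_power mult_single)

lemma mfunctional_monomial:
  "mfunctional N a (\<Prod>i\<in>{1..N}. mvar i ^ e i) = (\<Prod>i\<in>{1..N}. a (e i))"
proof -
  have "Poly_Mapping.lookup (\<Sum>i\<in>{1..N}. Poly_Mapping.single i (e i)) j = e j"
    if "j \<in> {1..N}" for j
    using that by (simp add: lookup_sum lookup_single when_def)
  then show ?thesis by (simp add: prod_mvar_power mfunctional_single)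
qed

end

theory Submission imports Defs begin

text \<open>
  The theorem is Gaussian quadrature in \<open>N\<close> variables. In one variable, a polynomial \<open>q\<close> of degree
  at most \<open>2 * n - 1\<close> is \<open>s * p n + r\<close> with \<open>s\<close> and \<open>r\<close> of degree less than \<open>n\<close>. Orthogonality
  annihilates \<open>s * p n\<close>, because \<open>s\<close> is a combination of \<open>p 0, \<dots>, p (n - 1)\<close>; the remainder \<open>r\<close>
  agrees with \<open>q\<close> at the roots of \<open>p n\<close> and is recovered from its values there by Lagrange
  interpolation. Hence the weights \<open>c i\<close>, the values of the functional on the Lagrange basis,
  represent the functional up to degree \<open>2 * n - 1\<close> (\<open>gauss_quadrature\<close>). These weights are forced:
  a representation of the moments is exact on the Lagrange basis, which reads off each \<open>c i\<close>.

  In \<open>N\<close> variables the functional is a product over the variables, so on a monomial whose exponents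
  are all at most \<open>2 * n - 1\<close> each factor may be replaced by its quadrature sum. Expanding the
  product of these sums gives a sum of point evaluations over all \<open>N\<close>-tuples of nodes
  (\<open>mfunctional_eq_node_sum\<close>). Each variable occurs in \<open>N - 1\<close> factors of the Vandermonde product,
  so the exponents in the power of order \<open>2 * k\<close> are at most \<open>2 * k * (N - 1) \<le> 2 * n - 1\<close>. Finally,
  evaluation at a point is a ring homomorphism, so it commutes with the Vandermonde product and with
  its power.
\<close>

section \<open>Linearity of the one-variable functional\<close>

lemma functional_eq_sum:
  assumes "degree q \<le> M"
  shows "functional a q = (\<Sum>h\<le>M. coeff q h * a h)"
  unfolding functional_def using assms
  by (intro sum.mono_neutral_left) (auto simp: coeff_eq_0)

lemma functional_add: "functional a (q + r) = functional a q + functional a r"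
proof -
  let ?M = "max (degree q) (degree r)"
  have "degree (q + r) \<le> ?M" by (rule degree_add_le_max)
  then show ?thesis
    by (simp add: functional_eq_sum[of _ ?M] ring_distribs sum.distrib)
qed

lemma functional_smult: "functional a (smult c q) = c * functional a q"
  by (simp add: functional_eq_sum[of _ "degree q"] degree_smult_le sum_distrib_left mult.assoc)

lemma functional_sum: "functional a (\<Sum>i\<in>A. f i) = (\<Sum>i\<in>A. functional a (f i))"
proof (induction A rule: infinite_finite_induct)
  case (insert i A)
  then show ?case by (simp add: functional_add)
qed (simp_all add: functional_def)

text \<open>Prescribing the moments up to \<open>M\<close> prescribes the functional up to degree \<open>M\<close>.\<close>

lemma functional_eq_node_sum:
  assumes moments: "\<forall>h\<le>M. a h = (\<Sum>i\<in>I. c i * z i ^ h)"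
    and "degree q \<le> M"
  shows "functional a q = (\<Sum>i\<in>I. c i * poly q (z i))"
proof -
  have "functional a q = (\<Sum>h\<le>degree q. \<Sum>i\<in>I. coeff q h * (c i * z i ^ h))"
    unfolding functional_def using assms by (intro sum.cong) (auto simp: sum_distrib_left)
  also have "\<dots> = (\<Sum>i\<in>I. \<Sum>h\<le>degree q. coeff q h * (c i * z i ^ h))"
    by (rule sum.swap)
  also have "\<dots> = (\<Sum>i\<in>I. c i * poly q (z i))"
    by (simp add: poly_altdef sum_distrib_left mult.left_commute)
  finally show ?thesis .
qed

section \<open>Lagrange interpolation\<close>

definition lagrange_basis :: "'i set \<Rightarrow> ('i \<Rightarrow> 'a::field) \<Rightarrow> 'i \<Rightarrow> 'a poly"
  where "lagrange_basis I z i = (\<Prod>j\<in>I - {i}. smult (inverse (z i - z j)) [:- z j, 1:])"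

lemma poly_lagrange_basis:
  assumes "finite I" "inj_on z I" "i \<in> I" "j \<in> I"
  shows "poly (lagrange_basis I z i) (z j) = (if j = i then 1 else 0)"
proof (cases "j = i")
  case True
  have "poly (smult (inverse (z i - z l)) [:- z l, 1:]) (z i) = 1" if "l \<in> I - {i}" for l
  proof -
    have "z i - z l \<noteq> 0"
      using that assms by (auto dest: inj_onD)
    moreover have "poly (smult (inverse (z i - z l)) [:- z l, 1:]) (z i) = inverse (z i - z l) * (z i - z l)"
      by (simp add: algebra_simps)
    ultimately show ?thesis by simp
  qed
  then show ?thesis
    unfolding lagrange_basis_def poly_prod True by simp
next
  case False
  then show ?thesis
    using assms by (auto simp: lagrange_basis_def poly_prod intro!: prod_zero bexI[of _ j])
qed

lemma degree_lagrange_basis_less: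
  assumes "finite I" "i \<in> I"
  shows "degree (lagrange_basis I z i) < card I"
proof -
  have "degree (lagrange_basis I z i) \<le> (\<Sum>j\<in>I - {i}. degree (smult (inverse (z i - z j)) [:- z j, 1:]))"
    unfolding lagrange_basis_def
    by (rule degree_prod_sum_le[unfolded comp_def]) (use assms in simp)
  also have "\<dots> \<le> (\<Sum>j\<in>I - {i}. 1)"
    by (intro sum_mono) auto
  also have "\<dots> = card I - 1"
    using assms by simp
  also have "\<dots> < card I"
    using assms by (intro diff_less) (auto simp: card_gt_0_iff)
  finally show ?thesis .
qed

lemma lagrange_interpolation:
  assumes "finite I" "inj_on z I" "degree r < card I"
  shows "r = (\<Sum>i\<in>I. smult (poly r (z i)) (lagrange_basis I z i))"
proof (rule poly_eqI_degree[where A = "z ` I"])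
  fix x assume "x \<in> z ` I"
  then obtain j where j: "j \<in> I" "x = z j" by blast
  have "poly (\<Sum>i\<in>I. smult (poly r (z i)) (lagrange_basis I z i)) x =
      (\<Sum>i\<in>I. if i = j then poly r (z i) else 0)"
    unfolding poly_sum using assms j by (intro sum.cong) (auto simp: poly_lagrange_basis)
  then show "poly r x = poly (\<Sum>i\<in>I. smult (poly r (z i)) (lagrange_basis I z i)) x"
    using assms j by simp
next
  show "degree (\<Sum>i\<in>I. smult (poly r (z i)) (lagrange_basis I z i)) < card (z ` I)"
    using assms degree_lagrange_basis_less[of I _ z]
    by (auto simp: card_image intro!: degree_sum_less le_less_trans[OF degree_smult_le])
qed (use assms in \<open>simp add: card_image\<close>)

section \<open>Gaussian quadrature\<close>

text \<open>
  A polynomial of degree less than \<open>n\<close> is a combination of \<open>p 0, \<dots>, p (n - 1)\<close>.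
  The degree bound is phrased through vanishing coefficients so that the zero polynomial needs no
  separate treatment: subtracting a multiple of \<open>p d\<close> removes the coefficient at \<open>d\<close>.
\<close>

lemma orthogonal_lower_degree:
  assumes "orthogonal_polynomial_system a p"
    and "d \<le> n" "\<And>i. i \<ge> d \<Longrightarrow> coeff s i = 0"
  shows "functional a (s * p n) = 0"
  using assms(2,3)
proof (induction d arbitrary: s)
  case 0
  then have "s = 0" by (intro poly_eqI) simp
  then show ?case by (simp add: functional_def)
next
  case (Suc d)
  have p: "p d \<noteq> 0" "degree (p d) = d" "functional a (p d * p n) = 0"
    using assms(1) Suc.prems(1) unfolding orthogonal_polynomial_system_def by auto
  define b where "b = coeff s d / coeff (p d) d"
  define s' where "s' = s - smult b (p d)"
  have "coeff (p d) d \<noteq> 0"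
    using p by (metis leading_coeff_0_iff)
  then have "coeff s' i = 0" if "i \<ge> d" for i
    using that p(2) Suc.prems(2)[of i] by (cases "i = d") (auto simp: s'_def b_def coeff_eq_0)
  then have "functional a (s' * p n) = 0"
    using Suc.IH Suc.prems(1) by simp
  moreover have "s * p n = s' * p n + smult b (p d * p n)"
    by (simp add: s'_def algebra_simps)
  ultimately show ?case
    using p(3) by (simp add: functional_add functional_smult)
qed

text \<open>
  An interpolatory rule with \<open>n\<close> nodes is exact below degree \<open>n\<close>; taking the nodes at the roots of
  \<open>p n\<close> doubles this range, because dividing by \<open>p n\<close> replaces a polynomial by a remainder with
  the same node values, and the functional vanishes on the discarded multiple of \<open>p n\<close>, whose
  cofactor has degree less than \<open>n\<close>.
\<close>

lemma gauss_quadrature: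
  fixes z :: "'i \<Rightarrow> 'a::field_char_0"
  assumes "orthogonal_polynomial_system a p"
    and "finite I" "inj_on z I" "card I = n" "n \<ge> 1"
    and roots: "\<And>i. i \<in> I \<Longrightarrow> poly (p n) (z i) = 0"
    and "degree q \<le> 2 * n - 1"
  shows "functional a q = (\<Sum>i\<in>I. functional a (lagrange_basis I z i) * poly q (z i))"
proof -
  define s where "s = q div p n"
  define r where "r = q mod p n"
  have q: "q = s * p n + r"
    by (simp add: s_def r_def)
  have p: "p n \<noteq> 0" "degree (p n) = n"
    using assms(1) unfolding orthogonal_polynomial_system_def by auto
  have r: "degree r < n"
    using degree_mod_less[of "p n" q] p \<open>n \<ge> 1\<close> unfolding r_def by auto
  have "coeff s i = 0" if "i \<ge> n" for i
  proof (cases "s = 0")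
    case False
    then have "degree (s * p n) = degree s + n"
      using p by (simp add: degree_mult_eq)
    then have "degree q = degree s + n"
      using r unfolding q by (simp add: degree_add_eq_left)
    then show ?thesis
      using that assms(5,7) by (intro coeff_eq_0) simp
  qed simp
  then have "functional a (s * p n) = 0"
    using orthogonal_lower_degree[OF assms(1) order_refl] by blast
  then have "functional a q = functional a r"
    by (simp add: q functional_add)
  also have "\<dots> = functional a (\<Sum>i\<in>I. smult (poly r (z i)) (lagrange_basis I z i))"
    using lagrange_interpolation[of I z r] assms r by simp
  also have "\<dots> = (\<Sum>i\<in>I. functional a (lagrange_basis I z i) * poly r (z i))"
    by (simp add: functional_sum functional_smult mult.commute)
  also have "\<dots> = (\<Sum>i\<in>I. functional a (lagrange_basis I z i) * poly q (z i))"
    using roots by (simp add: q)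
  finally show ?thesis .
qed

text \<open>
  On the Lagrange polynomial of the node \<open>z i\<close>, which vanishes at every other node, a node sum
  reduces to its single coefficient \<open>c i\<close>.
\<close>

lemma quadrature_weight_unique:
  assumes "finite I" "inj_on z I" "card I \<le> Suc M" "i \<in> I"
    and moments: "\<forall>h\<le>M. a h = (\<Sum>i\<in>I. c i * z i ^ h)"
  shows "c i = functional a (lagrange_basis I z i)"
proof -
  have "degree (lagrange_basis I z i) \<le> M"
    using degree_lagrange_basis_less[of I i z] assms by simp
  then have "functional a (lagrange_basis I z i) = (\<Sum>j\<in>I. c j * poly (lagrange_basis I z i) (z j))"
    by (rule functional_eq_node_sum[OF moments])
  also have "\<dots> = (\<Sum>j\<in>I. if j = i then c j else 0)"
    using assms by (intro sum.cong) (auto simp: poly_lagrange_basis)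
  finally show ?thesis
    using assms by simp
qed

section \<open>Linear extension from monomials and evaluation at a point\<close>

text \<open>
  Evaluation of a polynomial is the linear extension of its values on monomials. It is a ring
  homomorphism because those values are multiplicative in the exponent vector.
\<close>

definition linear_extension :: "('m \<Rightarrow> 'a::comm_ring_1) \<Rightarrow> ('m \<Rightarrow>\<^sub>0 'a) \<Rightarrow> 'a"
  where "linear_extension \<phi> q =
    (\<Sum>m\<in>Poly_Mapping.keys q. Poly_Mapping.lookup q m * \<phi> m)"

lemma linear_extension_eq_sum:
  assumes "finite A" "Poly_Mapping.keys q \<subseteq> A"
  shows "linear_extension \<phi> q = (\<Sum>m\<in>A. Poly_Mapping.lookup q m * \<phi> m)"
  unfolding linear_extension_def using assms
  by (intro sum.mono_neutral_left) (auto simp: in_keys_iff)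

lemma linear_extension_add:
  "linear_extension \<phi> (q + r) = linear_extension \<phi> q + linear_extension \<phi> r"
proof -
  let ?A = "Poly_Mapping.keys q \<union> Poly_Mapping.keys r"
  have "Poly_Mapping.keys (q + r) \<subseteq> ?A" by (rule Poly_Mapping.keys_add)
  then show ?thesis
    by (simp add: linear_extension_eq_sum[of ?A] lookup_add ring_distribs sum.distrib)
qed

lemma linear_extension_diff:
  "linear_extension \<phi> (q - r) = linear_extension \<phi> q - linear_extension \<phi> r"
  using linear_extension_add[of \<phi> "q - r" r] by simp

lemma linear_extension_sum:
  "linear_extension \<phi> (\<Sum>i\<in>A. f i) = (\<Sum>i\<in>A. linear_extension \<phi> (f i))"
proof (induction A rule: infinite_finite_induct)
  case (insert i A)
  then show ?case by (simp add: linear_extension_add)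
qed (simp_all add: linear_extension_def)

lemma linear_extension_single: "linear_extension \<phi> (Poly_Mapping.single m b) = b * \<phi> m"
  by (simp add: linear_extension_eq_sum[of "{m}"])

lemma sum_of_terms:
  "(\<Sum>m\<in>Poly_Mapping.keys q. Poly_Mapping.single m (Poly_Mapping.lookup q m)) = q"
proof (rule poly_mapping_eqI)
  fix m
  show "Poly_Mapping.lookup (\<Sum>m\<in>Poly_Mapping.keys q. Poly_Mapping.single m (Poly_Mapping.lookup q m)) m =
      Poly_Mapping.lookup q m"
    by (cases "m \<in> Poly_Mapping.keys q")
      (simp_all add: lookup_sum lookup_single when_def in_keys_iff)
qed

lemma linear_extension_mult:
  fixes \<phi> :: "'m::monoid_add \<Rightarrow> 'a::comm_ring_1"
  assumes "\<And>m m'. \<phi> (m + m') = \<phi> m * \<phi> m'"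
  shows "linear_extension \<phi> (q * r) = linear_extension \<phi> q * linear_extension \<phi> r"
proof -
  let ?q = "Poly_Mapping.lookup q" and ?r = "Poly_Mapping.lookup r"
  have "q * r = (\<Sum>m\<in>Poly_Mapping.keys q. Poly_Mapping.single m (?q m)) *
      (\<Sum>m\<in>Poly_Mapping.keys r. Poly_Mapping.single m (?r m))"
    by (simp add: sum_of_terms)
  also have "\<dots> = (\<Sum>m\<in>Poly_Mapping.keys q. \<Sum>m'\<in>Poly_Mapping.keys r.
      Poly_Mapping.single (m + m') (?q m * ?r m'))"
    by (simp add: sum_product mult_single)
  finally have "linear_extension \<phi> (q * r) = (\<Sum>m\<in>Poly_Mapping.keys q. \<Sum>m'\<in>Poly_Mapping.keys r.
      (?q m * ?r m') * (\<phi> m * \<phi> m'))"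
    by (simp add: linear_extension_sum linear_extension_single assms)
  also have "\<dots> = linear_extension \<phi> q * linear_extension \<phi> r"
    by (simp add: linear_extension_def sum_product mult.assoc mult.left_commute)
  finally show ?thesis .
qed

text \<open>Indeterminates outside \<open>x\<^sub>1, \<dots>, x\<^sub>N\<close> are evaluated at 1.\<close>

definition eval_at :: "nat \<Rightarrow> (nat \<Rightarrow> 'a::comm_ring_1) \<Rightarrow> 'a mpoly \<Rightarrow> 'a"
  where "eval_at N z = linear_extension (\<lambda>m. \<Prod>j\<in>{1..N}. z j ^ Poly_Mapping.lookup m j)"

lemma eval_at_diff: "eval_at N z (q - r) = eval_at N z q - eval_at N z r"
  by (simp add: eval_at_def linear_extension_diff)

lemma eval_at_mult: "eval_at N z (q * r) = eval_at N z q * eval_at N z r"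
  unfolding eval_at_def
  by (rule linear_extension_mult) (simp add: lookup_add power_add prod.distrib)

lemma eval_at_one: "eval_at N z 1 = 1"
  by (simp add: eval_at_def linear_extension_def)

lemma eval_at_power: "eval_at N z (q ^ e) = eval_at N z q ^ e"
  by (induction e) (simp_all add: eval_at_one eval_at_mult)

lemma eval_at_prod: "eval_at N z (\<Prod>i\<in>A. f i) = (\<Prod>i\<in>A. eval_at N z (f i))"
  by (induction A rule: infinite_finite_induct) (simp_all add: eval_at_one eval_at_mult)

lemma eval_at_mvar:
  assumes "i \<in> {1..N}"
  shows "eval_at N z (mvar i) = z i"
proof -
  have "eval_at N z (mvar i) = (\<Prod>j\<in>{1..N}. if j = i then z j else 1)"
    unfolding eval_at_def mvar_def linear_extension_single mult_1
    by (intro prod.cong) (auto simp: lookup_single when_def)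
  then show ?thesis using assms by simp
qed

lemma eval_at_vandermonde: "eval_at N z (vandermonde N mvar) = vandermonde N z"
  unfolding vandermonde_def eval_at_prod
  by (intro prod.cong) (auto simp: eval_at_diff eval_at_mvar)

section \<open>Degrees in a single variable\<close>

definition degree_in_le :: "nat \<Rightarrow> nat \<Rightarrow> 'a::comm_ring_1 mpoly \<Rightarrow> bool"
  where "degree_in_le l d q \<longleftrightarrow> (\<forall>m\<in>Poly_Mapping.keys q. Poly_Mapping.lookup m l \<le> d)"

lemma degree_in_le_one: "degree_in_le l 0 1"
  by (simp add: degree_in_le_def)

lemma degree_in_le_mult:
  assumes "degree_in_le l d q" "degree_in_le l e r"
  shows "degree_in_le l (d + e) (q * r)"
  using assms keys_mult[of q r]
  by (fastforce simp: degree_in_le_def lookup_add intro: add_mono)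

lemma degree_in_le_power:
  assumes "degree_in_le l d q"
  shows "degree_in_le l (e * d) (q ^ e)"
  by (induction e) (simp_all add: degree_in_le_one degree_in_le_mult assms)

lemma degree_in_le_prod:
  assumes "\<And>i. i \<in> A \<Longrightarrow> degree_in_le l (d i) (f i)"
  shows "degree_in_le l (\<Sum>i\<in>A. d i) (\<Prod>i\<in>A. f i)"
  using assms
  by (induction A rule: infinite_finite_induct) (simp_all add: degree_in_le_one degree_in_le_mult)

lemma degree_in_le_mono: "degree_in_le l d q \<Longrightarrow> d \<le> e \<Longrightarrow> degree_in_le l e q"
  by (auto simp: degree_in_le_def)

lemma degree_in_le_mvar_diff:
  "degree_in_le l (if l = i \<or> l = j then 1 else 0) (mvar j - mvar i :: 'a::comm_ring_1 mpoly)"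
  using keys_diff[of "mvar j :: 'a mpoly" "mvar i"]
  by (auto simp: degree_in_le_def mvar_def lookup_single when_def split: if_splits)

text \<open>
  The factors in which \<open>x\<^sub>l\<close> occurs are indexed by the partner of \<open>l\<close> in the pair, which is one
  of the other \<open>N - 1\<close> indices.
\<close>

lemma degree_in_le_vandermonde:
  assumes "l \<in> {1..N}"
  shows "degree_in_le l (N - 1) (vandermonde N mvar :: 'a::comm_ring_1 mpoly)"
proof -
  let ?P = "{(i, j). 1 \<le> i \<and> i < j \<and> j \<le> N}"
  let ?Q = "{x \<in> ?P. l = fst x \<or> l = snd x}"
  let ?d = "\<lambda>x. if l = fst x \<or> l = snd x then 1 else 0 :: nat"
  have fin: "finite ?P"
    by (rule finite_subset[of _ "{1..N} \<times> {1..N}"]) auto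
  have "degree_in_le l (\<Sum>x\<in>?P. ?d x) (vandermonde N mvar :: 'a mpoly)"
    unfolding vandermonde_def case_prod_beta
    by (intro degree_in_le_prod degree_in_le_mvar_diff)
  moreover have "(\<Sum>x\<in>?P. ?d x) \<le> N - 1"
  proof -
    have "(\<Sum>x\<in>?P. ?d x) = card ?Q"
      using fin by (simp add: sum.If_cases Int_def)
    also have "card ?Q \<le> card ({1..N} - {l})"
      by (rule card_inj_on_le[of "\<lambda>x. if fst x = l then snd x else fst x"])
        (auto simp: inj_on_def split: if_splits)
    also have "\<dots> = N - 1"
      using assms by simp
    finally show ?thesis .
  qed
  ultimately show ?thesis
    by (rule degree_in_le_mono)
qed

section \<open>Quadrature in several variables\<close>

text \<open>
  Only the degree in each variable separately matters, since every factor \<open>a (m l)\<close> of the product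
  functional is replaced by its own node sum.
\<close>

lemma mfunctional_eq_node_sum:
  assumes "finite I"
    and moments: "\<forall>h\<le>M. a h = (\<Sum>t\<in>I. c t * z t ^ h)"
    and deg: "\<And>l. l \<in> {1..N} \<Longrightarrow> degree_in_le l M q"
  shows "mfunctional N a q =
    (\<Sum>i\<in>{1..N} \<rightarrow>\<^sub>E I. (\<Prod>j\<in>{1..N}. c (i j)) * eval_at N (\<lambda>j. z (i j)) q)"
proof -
  let ?q = "Poly_Mapping.lookup q" and ?K = "Poly_Mapping.keys q"
  let ?c = "\<lambda>i. \<Prod>j\<in>{1..N}. c (i j)"
  let ?z = "\<lambda>i m. \<Prod>j\<in>{1..N}. z (i j) ^ Poly_Mapping.lookup m j"
  have "mfunctional N a q = (\<Sum>m\<in>?K. ?q m * (\<Sum>i\<in>{1..N} \<rightarrow>\<^sub>E I. ?c i * ?z i m))"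
    unfolding mfunctional_def
  proof (intro sum.cong arg_cong2[where f = "(*)"] refl)
    fix m assume "m \<in> ?K"
    then have "(\<Prod>l\<in>{1..N}. a (Poly_Mapping.lookup m l)) =
        (\<Prod>l\<in>{1..N}. \<Sum>t\<in>I. c t * z t ^ Poly_Mapping.lookup m l)"
      using moments deg by (intro prod.cong) (auto simp: degree_in_le_def)
    also have "\<dots> = (\<Sum>i\<in>{1..N} \<rightarrow>\<^sub>E I. ?c i * ?z i m)"
      using \<open>finite I\<close> by (simp add: prod_sum_PiE prod.distrib)
    finally show "(\<Prod>l\<in>{1..N}. a (Poly_Mapping.lookup m l)) = (\<Sum>i\<in>{1..N} \<rightarrow>\<^sub>E I. ?c i * ?z i m)" .
  qed
  also have "\<dots> = (\<Sum>m\<in>?K. \<Sum>i\<in>{1..N} \<rightarrow>\<^sub>E I. ?c i * (?q m * ?z i m))"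
    by (simp add: sum_distrib_left mult.left_commute)
  also have "\<dots> = (\<Sum>i\<in>{1..N} \<rightarrow>\<^sub>E I. \<Sum>m\<in>?K. ?c i * (?q m * ?z i m))"
    by (rule sum.swap)
  also have "\<dots> = (\<Sum>i\<in>{1..N} \<rightarrow>\<^sub>E I. ?c i * eval_at N (\<lambda>j. z (i j)) q)"
    by (simp add: eval_at_def linear_extension_def sum_distrib_left)
  finally show ?thesis .
qed

theorem corollary9:
  fixes a :: "nat \<Rightarrow> 'a::field_char_0"
    and p :: "nat \<Rightarrow> 'a poly"
    and \<zeta> :: "nat \<Rightarrow> nat \<Rightarrow> 'a"
    and n k N :: nat
  assumes "a 0 \<noteq> 0"
    and "orthogonal_polynomial_system a p"
    and "\<And>m. bij_betw (\<zeta> m) {1..m} {x. poly (p m) x = 0}"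
    and "n \<ge> 1" and "k \<ge> 1" and "N \<ge> 1"
    and "2 * k * (N - 1) \<le> 2 * n - 1"
  shows "(\<exists>!c. c \<in> extensional {1..n} \<and>
             (\<forall>h\<le>2 * n - 1. a h = (\<Sum>i\<in>{1..n}. c i * \<zeta> n i ^ h))) \<and>
         (\<forall>c. (\<forall>h\<le>2 * n - 1. a h = (\<Sum>i\<in>{1..n}. c i * \<zeta> n i ^ h)) \<longrightarrow>
             mfunctional N a (vandermonde N mvar ^ (2 * k)) =
             (\<Sum>i\<in>{1..N} \<rightarrow>\<^sub>E {1..n}.
                (\<Prod>j\<in>{1..N}. c (i j)) * vandermonde N (\<lambda>j. \<zeta> n (i j)) ^ (2 * k)))"
proof
  let ?w = "\<lambda>i. functional a (lagrange_basis {1..n} (\<zeta> n) i)"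
  have inj: "inj_on (\<zeta> n) {1..n}"
    using assms(3) by (rule bij_betw_imp_inj_on)
  have roots: "poly (p n) (\<zeta> n i) = 0" if "i \<in> {1..n}" for i
    using bij_betwE[OF assms(3)] that by blast
  show "\<exists>!c. c \<in> extensional {1..n} \<and>
      (\<forall>h\<le>2 * n - 1. a h = (\<Sum>i\<in>{1..n}. c i * \<zeta> n i ^ h))"
  proof (rule ex1I)
    have "a h = (\<Sum>i\<in>{1..n}. ?w i * \<zeta> n i ^ h)" if "h \<le> 2 * n - 1" for h
      using gauss_quadrature[OF assms(2) _ inj, of n "monom 1 h"] roots that \<open>n \<ge> 1\<close>
      by (simp add: functional_monom degree_monom_eq poly_monom)
    then show "restrict ?w {1..n} \<in> extensional {1..n} \<and>
        (\<forall>h\<le>2 * n - 1. a h = (\<Sum>i\<in>{1..n}. restrict ?w {1..n} i * \<zeta> n i ^ h))"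
      by simp
  next
    fix c
    assume c: "c \<in> extensional {1..n} \<and>
      (\<forall>h\<le>2 * n - 1. a h = (\<Sum>i\<in>{1..n}. c i * \<zeta> n i ^ h))"
    have "c i = ?w i" if "i \<in> {1..n}" for i
      using quadrature_weight_unique[OF _ inj _ that, of "2 * n - 1" a c] c \<open>n \<ge> 1\<close> by simp
    then show "c = restrict ?w {1..n}"
      using c by (intro extensionalityI[of _ "{1..n}"]) auto
  qed
next
  have deg: "degree_in_le l (2 * n - 1) (vandermonde N mvar ^ (2 * k) :: 'a mpoly)" if "l \<in> {1..N}" for l
    using degree_in_le_power[OF degree_in_le_vandermonde[OF that]] assms(7)
    by (rule degree_in_le_mono)
  show "\<forall>c. (\<forall>h\<le>2 * n - 1. a h = (\<Sum>i\<in>{1..n}. c i * \<zeta> n i ^ h)) \<longrightarrow>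
      mfunctional N a (vandermonde N mvar ^ (2 * k)) =
      (\<Sum>i\<in>{1..N} \<rightarrow>\<^sub>E {1..n}.
        (\<Prod>j\<in>{1..N}. c (i j)) * vandermonde N (\<lambda>j. \<zeta> n (i j)) ^ (2 * k))"
  proof (intro allI impI)
    fix c
    assume "\<forall>h\<le>2 * n - 1. a h = (\<Sum>i\<in>{1..n}. c i * \<zeta> n i ^ h)"
    from mfunctional_eq_node_sum[OF finite_atLeastAtMost this deg]
    show "mfunctional N a (vandermonde N mvar ^ (2 * k)) =
      (\<Sum>i\<in>{1..N} \<rightarrow>\<^sub>E {1..n}.
        (\<Prod>j\<in>{1..N}. c (i j)) * vandermonde N (\<lambda>j. \<zeta> n (i j)) ^ (2 * k))"
      by (simp add: eval_at_power eval_at_vandermonde)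
  qed
qed

end
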